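(* Let $0\le\delta<1$, $\varphi\in\mathcal{S}^*(\delta)$, $\theta\in[0,\pi)$, let $-1/2<c<0$ and $w(z)=\cos(\pi c)\,z/2$, and let $F^\theta_{\alpha\beta}=H+\overline{G}$ be a sense-preserving harmonic mapping in $\mathbb{D}$ which is the horizontal shear of $C^\theta_{\alpha\beta}[\varphi]$ with dilatation $w_{\alpha\beta}=\alpha(1+\beta)w$. Then for all non-negative $\alpha,\beta$ satisfying $\alpha(1+\beta)\le1$ and $\alpha(2(1-\delta)+\beta)\le-2c$, we have $F^\theta_{\alpha\beta}\in\mathcal{CC}_{\mathbb{H}}$.
   Context: $\mathbb{D}=\{z\in\mathbb{C}:|z|<1\}$. For $0\le\delta<1$, $\mathcal{S}^*(\delta)$ is the class of analytic functions $\varphi$ in $\mathbb{D}$ with $\varphi(0)=0$, $\varphi'(0)=1$ and $\mathrm{Re}\,[z\varphi'(z)/\varphi(z)]>\delta$ for all $z\in\mathbb{D}$. Define $$C_{\alpha\beta}[\varphi](z)=\int_0^z\Big(\frac{\varphi(\zeta)}{\zeta(1-\zeta)^{\beta}}\Big)^{\alpha}\,d\zeta,\qquad C^\theta_{\alpha\beta}[\varphi](z)=e^{-i\theta}C_{\alpha\beta}[\varphi](e^{i\theta}z),\qquad z\in\mathbb{D},$$ with the analytic branches of the powers for which the integrand equals $1$ at $\zeta=0$. The horizontal shear of $C^\theta_{\alpha\beta}[\varphi]$ with dilatation $w_{\alpha\beta}$ is the harmonic mapping $F^\theta_{\alpha\beta}=H+\overline{G}$, with $H,G$ analytic in $\mathbb{D}$,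 $H-G=C^\theta_{\alpha\beta}[\varphi]$, $G'=w_{\alpha\beta}H'$, and normalization $H(0)=G(0)=0$, $H'(0)=1$, $G'(0)=0$. It is sense-preserving if $|H'|^2-|G'|^2>0$ (equivalently $|w_{\alpha\beta}|<1$) in $\mathbb{D}$. $\mathcal{CC}_{\mathbb{H}}$ is the class of harmonic mappings $f=h+\overline{g}$ in $\mathbb{D}$, with $h(0)=g(0)=0$, $h'(0)=1$, that are close-to-convex in $\mathbb{D}$, i.e. $f$ is univalent and $f(\mathbb{D})$ is a close-to-convex domain (its complement in $\mathbb{C}$ is a union of non-crossing closed half-lines). *)

theory Defs
  imports "HOL-Complex_Analysis.Complex_Analysis"
begin

abbreviation unit_disc :: "complex set" where
  "unit_disc \<equiv> ball 0 1"

(* At z = 0 the quotient has a removable singularity with value 1 > delta, so only z \<noteq> 0 is tested.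
   As x / 0 = 0 and delta \<ge> 0, the inequality includes phi z \<noteq> 0. *)
definition starlike_of_order :: "real \<Rightarrow> (complex \<Rightarrow> complex) set" where
  "starlike_of_order \<delta> = {\<phi>. \<phi> holomorphic_on unit_disc \<and> \<phi> 0 = 0 \<and> deriv \<phi> 0 = 1 \<and>
     (\<forall>z\<in>unit_disc - {0}. Re (z * deriv \<phi> z / \<phi> z) > \<delta>)}"

(* The branch of log g with value 0 at 0, for g holomorphic and zero-free in the disc with g 0 = 1;
   see log_branch_properties and log_branch_unique below. *)
definition log_branch :: "(complex \<Rightarrow> complex) \<Rightarrow> complex \<Rightarrow> complex" where
  "log_branch g = (SOME L. L holomorphic_on unit_disc \<and> L 0 = 0 \<and>
     (\<forall>z\<in>unit_disc. exp (L z) = g z))"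

definition power_branch :: "(complex \<Rightarrow> complex) \<Rightarrow> real \<Rightarrow> complex \<Rightarrow> complex" where
  "power_branch g a = (\<lambda>z. exp (of_real a * log_branch g z))"

lemma log_branch_exists:
  assumes "g holomorphic_on unit_disc" "g 0 = 1" "\<And>z. z \<in> unit_disc \<Longrightarrow> g z \<noteq> 0"
  shows "\<exists>L. L holomorphic_on unit_disc \<and> L 0 = 0 \<and> (\<forall>z\<in>unit_disc. exp (L z) = g z)"
proof -
  obtain M where M: "M holomorphic_on unit_disc" "\<And>z. z \<in> unit_disc \<Longrightarrow> g z = exp (M z)"
    by (rule contractible_imp_holomorphic_log
        [OF assms(1) convex_imp_contractible[OF convex_ball] assms(3)]) (assumption, rule that)
  have "exp (M 0) = 1" using M(2)[of 0] assms(2) by simp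
  then have "(\<lambda>z. M z - M 0) holomorphic_on unit_disc \<and> M 0 - M 0 = 0 \<and>
      (\<forall>z\<in>unit_disc. exp (M z - M 0) = g z)"
    using M by (simp add: exp_diff holomorphic_on_diff holomorphic_on_const)
  then show ?thesis by blast
qed

lemma log_branch_properties:
  assumes "g holomorphic_on unit_disc" "g 0 = 1" "\<And>z. z \<in> unit_disc \<Longrightarrow> g z \<noteq> 0"
  shows "log_branch g holomorphic_on unit_disc" "log_branch g 0 = 0"
    "\<And>z. z \<in> unit_disc \<Longrightarrow> exp (log_branch g z) = g z"
  using someI_ex[OF log_branch_exists[OF assms]] unfolding log_branch_def by auto

lemma log_branch_unique:
  assumes "L holomorphic_on unit_disc" "M holomorphic_on unit_disc" "L 0 = 0" "M 0 = 0"
    and "\<And>z. z \<in> unit_disc \<Longrightarrow> exp (L z) = exp (M z)" and z: "z \<in> unit_disc"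
  shows "L z = M z"
proof -
  have der: "(L has_field_derivative deriv L x) (at x)" "(M has_field_derivative deriv M x) (at x)"
    if "x \<in> unit_disc" for x
    by (rule holomorphic_derivI[OF _ open_ball that], fact)+
  have "((\<lambda>y. L y - M y) has_field_derivative 0) (at x within unit_disc)" if x: "x \<in> unit_disc" for x
  proof -
    have a: "((\<lambda>y. exp (L y)) has_field_derivative exp (L x) * deriv L x) (at x)"
      by (rule DERIV_fun_exp[OF der(1)[OF x]])
    have b: "((\<lambda>y. exp (M y)) has_field_derivative exp (M x) * deriv M x) (at x)"
      by (rule DERIV_fun_exp[OF der(2)[OF x]])
    have "((\<lambda>y. exp (L y)) has_field_derivative exp (M x) * deriv M x) (at x)"
      by (rule has_field_derivative_transform_within_open[OF b open_ball x]) (simp only: assms(5))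
    then have "exp (L x) * deriv L x = exp (M x) * deriv M x"
      by (rule DERIV_unique[OF a])
    then have "deriv L x = deriv M x" using assms(5)[OF x] by simp
    then have "((\<lambda>y. L y - M y) has_field_derivative 0) (at x)"
      using DERIV_diff[OF der[OF x]] by simp
    then show ?thesis by (rule has_field_derivative_at_within)
  qed
  then obtain k where k: "\<And>x. x \<in> unit_disc \<Longrightarrow> L x - M x = k"
    using has_field_derivative_zero_constant[OF convex_ball, of 0 1 "\<lambda>y. L y - M y"] by blast
  from k[of 0] k[OF z] assms(3,4) show ?thesis by simp
qed

(* The integrand (phi(z) / (z (1-z)^beta))^alpha; phi(z)/z is extended to 0 by phi'(0). *)
definition C_integrand :: "real \<Rightarrow> real \<Rightarrow> (complex \<Rightarrow> complex) \<Rightarrow> complex \<Rightarrow> complex" where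
  "C_integrand \<alpha> \<beta> \<phi> =
     power_branch (\<lambda>\<zeta>. (if \<zeta> = 0 then deriv \<phi> 0 else \<phi> \<zeta> / \<zeta>) / power_branch (\<lambda>\<xi>. 1 - \<xi>) \<beta> \<zeta>) \<alpha>"

definition C_op :: "real \<Rightarrow> real \<Rightarrow> (complex \<Rightarrow> complex) \<Rightarrow> complex \<Rightarrow> complex" where
  "C_op \<alpha> \<beta> \<phi> z = contour_integral (linepath 0 z) (C_integrand \<alpha> \<beta> \<phi>)"

definition C_rot :: "real \<Rightarrow> real \<Rightarrow> real \<Rightarrow> (complex \<Rightarrow> complex) \<Rightarrow> complex \<Rightarrow> complex" where
  "C_rot \<theta> \<alpha> \<beta> \<phi> z = exp (- \<i> * of_real \<theta>) * C_op \<alpha> \<beta> \<phi> (exp (\<i> * of_real \<theta>) * z)"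

definition harmonic_of :: "(complex \<Rightarrow> complex) \<Rightarrow> (complex \<Rightarrow> complex) \<Rightarrow> complex \<Rightarrow> complex" where
  "harmonic_of h g z = h z + cnj (g z)"

definition horizontal_shear ::
  "(complex \<Rightarrow> complex) \<Rightarrow> (complex \<Rightarrow> complex) \<Rightarrow> (complex \<Rightarrow> complex) \<Rightarrow> (complex \<Rightarrow> complex) \<Rightarrow> bool" where
  "horizontal_shear f w H G \<longleftrightarrow>
     H holomorphic_on unit_disc \<and> G holomorphic_on unit_disc \<and>
     (\<forall>z\<in>unit_disc. H z - G z = f z) \<and>
     (\<forall>z\<in>unit_disc. deriv G z = w z * deriv H z) \<and>
     H 0 = 0 \<and> G 0 = 0 \<and> deriv H 0 = 1 \<and> deriv G 0 = 0"

definition sense_preserving :: "(complex \<Rightarrow> complex) \<Rightarrow> (complex \<Rightarrow> complex) \<Rightarrow> bool" where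
  "sense_preserving H G \<longleftrightarrow>
     (\<forall>z\<in>unit_disc. (cmod (deriv H z))\<^sup>2 - (cmod (deriv G z))\<^sup>2 > 0)"

definition closed_half_line :: "complex \<Rightarrow> complex \<Rightarrow> complex set" where
  "closed_half_line a u = {a + of_real t * u |t. t \<ge> 0}"

definition open_half_line :: "complex \<Rightarrow> complex \<Rightarrow> complex set" where
  "open_half_line a u = {a + of_real t * u |t. t > 0}"

(* A half-line is given by its initial point a and unit direction u, so distinct pairs are distinct
   half-lines. Non-crossing means that the corresponding open half-lines are pairwise disjoint; the
   initial point of one may lie on another, as in the complement of a slit domain with a T-junction. *)
definition close_to_convex_domain :: "complex set \<Rightarrow> bool" where
  "close_to_convex_domain S \<longleftrightarrow> open S \<and> connected S \<and> S \<noteq> {} \<and>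
     (\<exists>R. (\<forall>(a, u)\<in>R. cmod u = 1) \<and>
          - S = (\<Union>(a, u)\<in>R. closed_half_line a u) \<and>
          pairwise (\<lambda>(a, u) (b, v). disjnt (open_half_line a u) (open_half_line b v)) R)"

(* Functions are total in HOL; only their values in the disc matter. *)
definition CC_H :: "(complex \<Rightarrow> complex) set" where
  "CC_H = {f. (\<exists>h g. h holomorphic_on unit_disc \<and> g holomorphic_on unit_disc \<and>
                 (\<forall>z\<in>unit_disc. f z = harmonic_of h g z) \<and>
                 h 0 = 0 \<and> g 0 = 0 \<and> deriv h 0 = 1) \<and>
              inj_on f unit_disc \<and> close_to_convex_domain (f ` unit_disc)}"

end

theory Submission
  imports Defs
begin

text \<open>
  Write \<open>T = H - G\<close> for the rotated integral transform.  Its derivative is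
  \<open>exp (\<alpha> L)\<close> after a rotation of the variable, where
  \<open>z L'(z) = z \<phi>'(z) / \<phi>(z) - 1 + \<beta> z / (1 - z)\<close>.  Since the real parts of \<open>z \<phi>' / \<phi>\<close> and of
  \<open>z / (1 - z)\<close> are bounded below by \<open>\<delta>\<close> and by \<open>- 1 / 2\<close>, the bound on
  \<open>\<alpha> (2 (1 - \<delta>) + \<beta>)\<close> gives \<open>Re (1 + z T'' / T') \<ge> 1 + c > 1 / 2\<close>:
  \<open>T\<close> is convex of order greater than one half (lemma \<open>C_rot_convex_of_order\<close>).

  This order has two consequences.  Jack's lemma applied to \<open>1 - 1 / T'\<close> shows that \<open>T'\<close> maps
  into the half-plane \<open>Re > 1 / 2\<close>, so \<open>T\<close> is injective.  And \<open>T\<close> then has a convex image: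
  along a segment in the image, \<open>\<bar>T\<^sup>-\<^sup>1\<bar>\<^sup>2\<close> has positive second derivative at each of its critical
  points, hence no interior maximum, so a segment moving with its endpoint can never touch the
  boundary of the image (lemma \<open>convex_image_unit_disc\<close>).

  The rest is the shear construction of Clunie and Sheil-Small.  The harmonic map is
  \<open>H + cnj G = T + 2 Re G\<close>, so in the coordinate \<open>T\<close> it moves points horizontally only, and
  \<open>\<bar>G'\<bar> < \<bar>H'\<bar>\<close> makes it strictly increasing along horizontal lines.  Hence it is injective on
  the convex set \<open>T(unit_disc)\<close> and its image meets each horizontal line in an interval
  (lemma \<open>shear_of_convex_map\<close>).  The complement of such an open set is a union of
  horizontal half-lines with disjoint interiors, which is close-to-convexity in its geometric form.
\<close>

section \<open>Jack's lemma\<close>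

lemma has_vector_derivative_along_line:
  fixes f :: "complex \<Rightarrow> complex"
  assumes "(f has_field_derivative D) (at (a + of_real s * v))"
  shows "((\<lambda>s. f (a + of_real s * v)) has_vector_derivative v * D) (at s)"
proof -
  have "((\<lambda>s. a + of_real s * v) has_vector_derivative v) (at s)"
    by (auto intro!: derivative_eq_intros)
  from field_vector_diff_chain_at[OF this assms] show ?thesis
    by (simp add: o_def)
qed

lemma has_real_derivative_cmod_squared:
  assumes "(p has_vector_derivative v) (at t)"
  shows "((\<lambda>t. (cmod (p t))\<^sup>2) has_real_derivative 2 * Re (cnj (p t) * v)) (at t)"
proof -
  have "((\<lambda>t. p t \<bullet> p t) has_derivative (\<lambda>h. p t \<bullet> (h *\<^sub>R v) + (h *\<^sub>R v) \<bullet> p t)) (at t)"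
    using assms unfolding has_vector_derivative_def by (intro has_derivative_inner)
  then show ?thesis
    unfolding has_field_derivative_def power2_norm_eq_inner
    by (rule has_derivative_eq_rhs) (auto simp: inner_complex_def fun_eq_iff algebra_simps)
qed

lemma has_real_derivative_Re:
  assumes "(p has_vector_derivative v) (at t)"
  shows "((\<lambda>t. Re (p t)) has_real_derivative Re v) (at t)"
  using bounded_linear.has_vector_derivative[OF bounded_linear_Re assms]
  by (simp add: has_real_derivative_iff_has_vector_derivative)

lemma Re_of_real_mult: "Re (of_real x * z) = x * Re z"
  by simp

text \<open>
  At a point \<open>z0\<close> of least modulus with \<open>\<bar>\<omega> z0\<bar> = 1\<close>, the function \<open>\<bar>\<omega>\<bar>\<close> is maximal on the circle
  through \<open>z0\<close>, so its angular derivative vanishes and \<open>z0 \<omega>'(z0) / \<omega>(z0)\<close> is real.  By the Schwarz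
  lemma \<open>\<bar>\<omega> (s z0)\<bar> \<le> s\<close> for \<open>s < 1\<close>, with equality at \<open>s = 1\<close>, so the radial derivative is
  at least \<open>1\<close>.
\<close>
lemma jack_lemma:
  assumes hol: "\<omega> holomorphic_on unit_disc" and zero: "\<omega> 0 = 0"
    and z1: "z1 \<in> unit_disc" "1 \<le> cmod (\<omega> z1)"
  obtains z0 k where "z0 \<in> unit_disc" "z0 \<noteq> 0" "cmod (\<omega> z0) = 1" "1 \<le> k"
    "z0 * deriv \<omega> z0 = of_real k * \<omega> z0"
proof -
  have cont: "continuous_on (cball 0 (cmod z1)) \<omega>"
    by (rule continuous_on_subset[OF holomorphic_on_imp_continuous_on[OF hol]]) (use z1 in auto)
  define K where "K = {z \<in> cball 0 (cmod z1). \<omega> z \<in> - ball 0 1}"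
  have "closed K"
    using continuous_closed_preimage[OF cont closed_cball closed_Compl[OF open_ball, of 0 1]]
    by (simp add: K_def vimage_def Int_def)
  moreover have "bounded K"
    by (rule bounded_subset[OF bounded_cball[of 0 "cmod z1"]]) (auto simp: K_def)
  ultimately have "compact K"
    by (simp add: compact_eq_bounded_closed)
  moreover have "z1 \<in> K"
    using z1 by (simp add: K_def)
  ultimately obtain z0 where z0: "z0 \<in> K" and min: "\<And>z. z \<in> K \<Longrightarrow> cmod z0 \<le> cmod z"
    using continuous_attains_inf[of K cmod] continuous_on_norm_id by blast
  define r where "r = cmod z0"
  have disc: "z0 \<in> unit_disc" and ge: "1 \<le> cmod (\<omega> z0)"
    using z0 z1 by (auto simp: K_def)
  have z0_nz: "z0 \<noteq> 0"
    using ge zero by auto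
  then have r: "0 < r" "r < 1"
    using disc by (auto simp: r_def)
  have less: "cmod (\<omega> z) < 1" if "cmod z < r" for z
  proof (rule ccontr)
    assume "\<not> cmod (\<omega> z) < 1"
    then have "z \<in> K"
      using that z0 by (auto simp: K_def r_def)
    from min[OF this] that show False
      by (simp add: r_def)
  qed
  have schwarz: "cmod (\<omega> (of_real r * z)) \<le> cmod z" if "cmod z < 1" for z
  proof (rule Schwarz_Lemma(1)[of "\<lambda>z. \<omega> (of_real r * z)"])
    have "(\<omega> \<circ> (\<lambda>z. of_real r * z)) holomorphic_on ball 0 1"
    proof (rule holomorphic_on_compose_gen[OF _ hol])
      show "(\<lambda>z. of_real r * z) ` unit_disc \<subseteq> unit_disc"
      proof (clarsimp simp: norm_mult)
        fix z :: complex assume "cmod z < 1"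
        then have "r * cmod z < 1"
          using mult_strict_mono[of r 1 "cmod z" 1] r by simp
        then show "\<bar>r\<bar> * cmod z < 1"
          using r by simp
      qed
    qed (intro holomorphic_intros)
    then show "(\<lambda>z. \<omega> (of_real r * z)) holomorphic_on ball 0 1"
      by (simp add: o_def)
    show "cmod (\<omega> (of_real r * z)) < 1" if "cmod z < 1" for z
      using r that by (intro less) (simp add: norm_mult)
  qed (use zero that in auto)
  have radial: "cmod (\<omega> (of_real s * z)) \<le> s" if "cmod z = r" "0 \<le> s" "s < 1" for s z
  proof -
    have eq: "of_real s * z = of_real r * (of_real s * z / of_real r)"
      using r by simp
    have n: "cmod (of_real s * z / of_real r) = s"
      using that r by (simp add: norm_mult norm_divide)
    show ?thesis
      using schwarz[of "of_real s * z / of_real r"] n that eq by simp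
  qed
  have deriv_at: "(\<omega> has_field_derivative deriv \<omega> z) (at z)" if "cmod z = r" for z
    by (rule holomorphic_derivI[OF hol open_ball]) (use that r in simp)
  have circle: "cmod (\<omega> z) \<le> 1" if "cmod z = r" for z
  proof -
    have "isCont \<omega> z"
      by (rule DERIV_isCont[OF deriv_at[OF that]])
    then have "((\<lambda>s. \<omega> (of_real s * z)) \<longlongrightarrow> \<omega> (of_real 1 * z)) (at_left (1::real))"
      by (intro isCont_tendsto_compose[where g = \<omega>] tendsto_intros) auto
    then have "((\<lambda>s. cmod (\<omega> (of_real s * z))) \<longlongrightarrow> cmod (\<omega> z)) (at_left (1::real))"
      by (auto intro: tendsto_norm)
    moreover have "\<forall>\<^sub>F s in at_left (1::real). cmod (\<omega> (of_real s * z)) \<le> 1"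
      using eventually_at_left_real[OF zero_less_one]
    proof eventually_elim
      case (elim s)
      then show ?case
        using radial[OF that, of s] by simp
    qed
    ultimately show ?thesis
      by (intro tendsto_upperbound) auto
  qed
  have one: "cmod (\<omega> z0) = 1"
    using circle[of z0] ge by (simp add: r_def)
  \<comment> \<open>As \<open>\<bar>\<omega> z0\<bar> = 1\<close>, this is the quotient \<open>z0 \<omega>'(z0) / \<omega>(z0)\<close>; its real and imaginary parts are,
      up to sign, half the radial and half the angular derivative of \<open>\<bar>\<omega>\<bar>\<^sup>2\<close>.\<close>
  define q where "q = cnj (\<omega> z0) * (z0 * deriv \<omega> z0)"
  have "((\<lambda>s. \<omega> (0 + of_real s * z0)) has_vector_derivative z0 * deriv \<omega> z0) (at 1)"
    by (rule has_vector_derivative_along_line) (use deriv_at[of z0] in \<open>simp add: r_def\<close>)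
  from has_real_derivative_cmod_squared[OF this]
  have d1: "((\<lambda>s. (cmod (\<omega> (of_real s * z0)))\<^sup>2) has_real_derivative 2 * Re q) (at 1)"
    by (simp add: q_def)
  have d2: "((\<lambda>s. (cmod (\<omega> (of_real s * z0)))\<^sup>2 - s\<^sup>2) has_real_derivative 2 * Re q - 2) (at 1)"
    by (rule DERIV_cong[OF DERIV_diff[OF d1 DERIV_power[OF DERIV_ident]]]) simp
  have Re_q: "1 \<le> Re q"
  proof (rule ccontr)
    assume "\<not> 1 \<le> Re q"
    then obtain d where d: "d > 0" "\<And>h. h > 0 \<Longrightarrow> h < d \<Longrightarrow>
        (cmod (\<omega> (of_real 1 * z0)))\<^sup>2 - 1\<^sup>2 < (cmod (\<omega> (of_real (1 - h) * z0)))\<^sup>2 - (1 - h)\<^sup>2"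
      using DERIV_neg_dec_left[OF d2] by auto
    define h where "h = min (d/2) (1/2)"
    have h: "0 < h" "h < d" "h < 1"
      using d(1) by (auto simp: h_def)
    have "(cmod (\<omega> (of_real (1 - h) * z0)))\<^sup>2 \<le> (1 - h)\<^sup>2"
      using radial[of z0 "1 - h"] h by (intro power_mono) (auto simp: r_def)
    with d(2)[OF h(1,2)] one show False
      by simp
  qed
  have "((\<lambda>t. z0 * exp (\<i> * of_real t)) has_vector_derivative z0 * \<i>) (at 0)"
    by (auto intro!: derivative_eq_intros has_vector_derivative_real_field)
  moreover have "(\<omega> has_field_derivative deriv \<omega> z0) (at (z0 * exp (\<i> * of_real 0)))"
    using deriv_at[of z0] by (simp add: r_def)
  ultimately have "((\<lambda>t. \<omega> (z0 * exp (\<i> * of_real t))) has_vector_derivative z0 * \<i> * deriv \<omega> z0) (at 0)"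
    using field_vector_diff_chain_at[of "\<lambda>t. z0 * exp (\<i> * of_real t)" "z0 * \<i>" 0 \<omega>]
    by (simp add: o_def)
  from has_real_derivative_cmod_squared[OF this]
  have d3: "((\<lambda>t. (cmod (\<omega> (z0 * exp (\<i> * of_real t))))\<^sup>2) has_real_derivative - 2 * Im q) (at 0)"
    by (simp add: q_def algebra_simps)
  have "- 2 * Im q = 0"
  proof (rule DERIV_local_max[OF d3 zero_less_one], intro allI impI)
    fix y :: real
    have "cmod (\<omega> (z0 * exp (\<i> * of_real y))) \<le> 1"
      by (rule circle) (simp add: norm_mult r_def)
    then show "(cmod (\<omega> (z0 * exp (\<i> * of_real y))))\<^sup>2 \<le> (cmod (\<omega> (z0 * exp (\<i> * of_real 0))))\<^sup>2"
      using one by (simp add: power_le_one)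
  qed
  then have q: "q = of_real (Re q)"
    by (simp add: complex_eq_iff)
  have "\<omega> z0 * cnj (\<omega> z0) = 1"
    using one by (simp add: complex_norm_square[symmetric])
  then have "z0 * deriv \<omega> z0 = q * \<omega> z0"
    unfolding q_def by (metis mult.assoc mult.commute mult.right_neutral)
  then have "z0 * deriv \<omega> z0 = of_real (Re q) * \<omega> z0"
    by (simp only: q[symmetric])
  with that[OF disc z0_nz one Re_q] show thesis .
qed

section \<open>Univalence and convexity\<close>

text \<open>
  The substitution \<open>T' = 1 / (1 - \<omega>)\<close> turns \<open>z T'' / T'\<close> into \<open>z \<omega>' / (1 - \<omega>)\<close>.  If \<open>\<bar>\<omega>\<bar>\<close> reached
  \<open>1\<close>, then at the point from Jack's lemma this would be \<open>k \<omega> / (1 - \<omega>)\<close> with \<open>k \<ge> 1\<close>, of real part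
  \<open>- k / 2 \<le> - 1 / 2\<close>.  So \<open>\<bar>1 - 1 / T'\<bar> < 1\<close> throughout the disc.
\<close>
lemma convex_order_half_imp_Re_deriv_pos:
  assumes hol: "T holomorphic_on unit_disc" and norm: "deriv T 0 = 1"
    and nz: "\<And>z. z \<in> unit_disc \<Longrightarrow> deriv T z \<noteq> 0"
    and conv: "\<And>z. z \<in> unit_disc \<Longrightarrow> - 1 / 2 < Re (z * deriv (deriv T) z / deriv T z)"
    and z: "z \<in> unit_disc"
  shows "0 < Re (deriv T z)"
proof -
  define \<omega> where "\<omega> = (\<lambda>z. 1 - inverse (deriv T z))"
  have hol': "deriv T holomorphic_on unit_disc"
    by (intro holomorphic_deriv hol open_ball)
  have hol\<omega>: "\<omega> holomorphic_on unit_disc"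
    unfolding \<omega>_def by (intro holomorphic_on_diff holomorphic_on_const holomorphic_on_inverse hol' nz)
  have "cmod (\<omega> z) < 1"
  proof (rule ccontr)
    assume "\<not> cmod (\<omega> z) < 1"
    then have "1 \<le> cmod (\<omega> z)"
      by simp
    moreover have "\<omega> 0 = 0"
      by (simp add: \<omega>_def norm)
    ultimately obtain z0 k where z0: "z0 \<in> unit_disc" "cmod (\<omega> z0) = 1" "1 \<le> k"
        and k: "z0 * deriv \<omega> z0 = of_real k * \<omega> z0"
      using jack_lemma[OF hol\<omega> _ z] by metis
    have T': "deriv T z0 \<noteq> 0"
      by (rule nz[OF z0(1)])
    have "(\<omega> has_field_derivative deriv (deriv T) z0 / (deriv T z0)\<^sup>2) (at z0)"
      unfolding \<omega>_def
      by (rule derivative_eq_intros refl holomorphic_derivI[OF hol' open_ball z0(1)] T')+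
        (simp add: power2_eq_square field_simps T')
    then have "deriv \<omega> z0 = deriv (deriv T) z0 / (deriv T z0)\<^sup>2"
      by (rule DERIV_imp_deriv)
    moreover have inv: "1 - \<omega> z0 = inverse (deriv T z0)"
      by (simp add: \<omega>_def)
    ultimately have "z0 * deriv (deriv T) z0 / deriv T z0 = z0 * deriv \<omega> z0 / (1 - \<omega> z0)"
      using T' by (simp add: power2_eq_square)
    then have eq: "z0 * deriv (deriv T) z0 / deriv T z0 = of_real k * (\<omega> z0 / (1 - \<omega> z0))"
      by (simp add: k)
    \<comment> \<open>The map \<open>u \<mapsto> u / (1 - u)\<close> takes the unit circle to the line \<open>Re = - 1 / 2\<close>.\<close>
    have "Re (\<omega> z0 / (1 - \<omega> z0)) = - 1 / 2"
    proof -
      have nz1: "1 - \<omega> z0 \<noteq> 0"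
        using inv T' by simp
      have 1: "(Re (\<omega> z0))\<^sup>2 + (Im (\<omega> z0))\<^sup>2 = 1"
        using z0(2) by (simp add: cmod_power2[symmetric])
      have "(1 - Re (\<omega> z0))\<^sup>2 + (Im (\<omega> z0))\<^sup>2 = 2 * (1 - Re (\<omega> z0))"
        using 1 by (simp add: power2_eq_square algebra_simps)
      moreover have "Re (\<omega> z0) \<noteq> 1"
        using 1 nz1 by (auto simp: complex_eq_iff)
      moreover have "Re (\<omega> z0) * (1 - Re (\<omega> z0)) - Im (\<omega> z0) * Im (\<omega> z0) = Re (\<omega> z0) - 1"
        using 1 by (simp add: power2_eq_square algebra_simps)
      ultimately show ?thesis
        by (simp add: Re_divide divide_simps)
    qed
    then have "Re (z0 * deriv (deriv T) z0 / deriv T z0) = - k / 2"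
      unfolding eq Re_of_real_mult by simp
    with conv[OF z0(1)] z0(3) show False
      by simp
  qed
  then have "(cmod (\<omega> z))\<^sup>2 < 1"
    by (simp add: power_less_one_iff abs_square_less_1)
  moreover define u where "u = inverse (deriv T z)"
  ultimately have "(1 - Re u)\<^sup>2 + (Im u)\<^sup>2 < 1"
    by (simp add: \<omega>_def u_def cmod_power2)
  then have "(Re u)\<^sup>2 + (Im u)\<^sup>2 < 2 * Re u"
    by (simp add: power2_eq_square algebra_simps)
  then have "0 < Re u"
    by (smt (verit) zero_le_power2)
  moreover have "deriv T z = inverse u"
    by (simp add: u_def)
  moreover have "0 < (Re u)\<^sup>2 + (Im u)\<^sup>2"
    using \<open>0 < Re u\<close> by (simp add: add_pos_nonneg)
  ultimately show ?thesis
    by simp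
qed

text \<open>
  The Noshiro-Warschawski criterion: along the segment from \<open>a\<close> to \<open>b\<close>, the component of \<open>T\<close> in the
  direction \<open>b - a\<close> strictly increases.
\<close>
lemma Re_deriv_pos_imp_inj_on:
  fixes T :: "complex \<Rightarrow> complex"
  assumes hol: "T holomorphic_on S" and S: "open S" "convex S"
    and pos: "\<And>z. z \<in> S \<Longrightarrow> 0 < Re (deriv T z)"
  shows "inj_on T S"
proof (rule inj_onI, rule ccontr)
  fix a b assume ab: "a \<in> S" "b \<in> S" "T a = T b" "a \<noteq> b"
  define v where "v = b - a"
  have v: "v \<noteq> 0"
    using ab by (simp add: v_def)
  define u where "u = (\<lambda>s. Re (cnj v * T (a + of_real s * v)))"
  have "u 0 < u 1"
  proof (rule DERIV_pos_imp_increasing[OF zero_less_one], intro exI conjI)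
    fix s :: real assume s: "0 \<le> s" "s \<le> 1"
    have "a + of_real s * v = (1 - s) *\<^sub>R a + s *\<^sub>R b"
      by (simp add: v_def scaleR_conv_of_real algebra_simps)
    then have in_S: "a + of_real s * v \<in> S"
      using S(2) ab s by (simp add: convex_alt)
    have "((\<lambda>s. T (a + of_real s * v)) has_vector_derivative v * deriv T (a + of_real s * v)) (at s)"
      by (rule has_vector_derivative_along_line holomorphic_derivI[OF hol S(1) in_S])+
    then have "((\<lambda>s. cnj v * T (a + of_real s * v)) has_vector_derivative
        cnj v * (v * deriv T (a + of_real s * v))) (at s)"
      by (rule has_vector_derivative_mult_right)
    moreover have "cnj v * (v * deriv T (a + of_real s * v)) =
        of_real ((cmod v)\<^sup>2) * deriv T (a + of_real s * v)"
      by (simp only: complex_norm_square) (simp add: ac_simps)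
    ultimately show "(u has_real_derivative (cmod v)\<^sup>2 * Re (deriv T (a + of_real s * v))) (at s)"
      unfolding u_def by (metis has_real_derivative_Re Re_of_real_mult)
    show "0 < (cmod v)\<^sup>2 * Re (deriv T (a + of_real s * v))"
      using v pos[OF in_S] by simp
  qed
  then show False
    using ab by (simp add: u_def v_def)
qed

text \<open>
  A maximum principle for \<open>u = \<bar>p\<bar>\<^sup>2\<close>, where \<open>p\<close> is the preimage of the segment under \<open>T\<close> and
  \<open>q = p' = v / T'(p)\<close>.  At a critical point \<open>cnj p q\<close> is purely imaginary, and therefore
  \<open>u'' = 2 \<bar>q\<bar>\<^sup>2 Re (1 + p T''(p) / T'(p)) > 0\<close>.  So \<open>u\<close> has no maximum inside the segment.
\<close>
lemma inverse_along_segment_bound: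
  assumes hol: "T holomorphic_on unit_disc" and inj: "inj_on T unit_disc"
    and conv: "\<And>z. z \<in> unit_disc \<Longrightarrow> 0 < 1 + Re (z * deriv (deriv T) z / deriv T z)"
    and ab: "a \<in> unit_disc" "b \<in> unit_disc"
    and seg: "closed_segment (T a) (T b) \<subseteq> T ` unit_disc"
  shows "closed_segment (T a) (T b) \<subseteq> T ` cball 0 (max (cmod a) (cmod b))"
proof (cases "T a = T b")
  case True
  then show ?thesis
    by auto
next
  case False
  obtain g where g: "g holomorphic_on (T ` unit_disc)"
      "\<And>z. z \<in> unit_disc \<Longrightarrow> deriv T z * deriv g (T z) = 1"
      "\<And>z. z \<in> unit_disc \<Longrightarrow> g (T z) = z"
    using holomorphic_has_inverse[OF hol open_ball inj] by metis
  have open_image: "open (T ` unit_disc)"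
    by (rule open_mapping_thm3[OF hol open_ball inj])
  have nz: "deriv T z \<noteq> 0" if "z \<in> unit_disc" for z
    by (rule holomorphic_injective_imp_regular[OF hol open_ball inj that])
  define v where "v = T b - T a"
  have v: "v \<noteq> 0"
    using False by (simp add: v_def)
  define p where "p = (\<lambda>s. g (T a + of_real s * v))"
  define q where "q = (\<lambda>s. v / deriv T (p s))"
  have line: "T a + of_real s * v \<in> closed_segment (T a) (T b)" if "s \<in> {0..1}" for s
    using that by (auto simp: in_segment v_def scaleR_conv_of_real algebra_simps intro!: exI[of _ s])
  have p_disc: "p s \<in> unit_disc" and T_p: "T (p s) = T a + of_real s * v" if s: "s \<in> {0..1}" for s
  proof -
    obtain z where z: "z \<in> unit_disc" "T a + of_real s * v = T z"
      using seg line[OF s] by blast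
    then have "p s = z"
      by (simp add: p_def g(3))
    then show "p s \<in> unit_disc" "T (p s) = T a + of_real s * v"
      using z by simp_all
  qed
  have p': "(p has_vector_derivative q s) (at s)" if s: "s \<in> {0..1}" for s
  proof -
    have "T a + of_real s * v \<in> T ` unit_disc"
      using seg line[OF s] by blast
    then have "(g has_field_derivative deriv g (T a + of_real s * v)) (at (T a + of_real s * v))"
      by (rule holomorphic_derivI[OF g(1) open_image])
    from has_vector_derivative_along_line[OF this]
    have "(p has_vector_derivative v * deriv g (T (p s))) (at s)"
      unfolding T_p[OF s] by (simp add: p_def)
    moreover have "v * deriv g (T (p s)) = q s"
      using g(2)[OF p_disc[OF s]] nz[OF p_disc[OF s]] by (simp add: q_def field_simps)
    ultimately show ?thesis
      by simp
  qed
  have hol': "deriv T holomorphic_on unit_disc"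
    by (intro holomorphic_deriv hol open_ball)
  have q': "(q has_vector_derivative - (q s)\<^sup>2 * deriv (deriv T) (p s) / deriv T (p s)) (at s)"
    if s: "s \<in> {0..1}" for s
  proof -
    note d = nz[OF p_disc[OF s]]
    have "((\<lambda>z. v / deriv T z) has_field_derivative
        - v * deriv (deriv T) (p s) / (deriv T (p s))\<^sup>2) (at (p s))"
      by (rule derivative_eq_intros refl holomorphic_derivI[OF hol' open_ball p_disc[OF s]] d)+
        (simp add: power2_eq_square)
    from field_vector_diff_chain_at[OF p'[OF s] this]
    have "(q has_vector_derivative q s * (- v * deriv (deriv T) (p s) / (deriv T (p s))\<^sup>2)) (at s)"
      by (simp add: o_def q_def)
    moreover have "q s * (- v * deriv (deriv T) (p s) / (deriv T (p s))\<^sup>2) =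
        - (q s)\<^sup>2 * deriv (deriv T) (p s) / deriv T (p s)"
      using d by (simp add: q_def field_simps power2_eq_square)
    ultimately show ?thesis
      by simp
  qed
  define u where "u = (\<lambda>s. (cmod (p s))\<^sup>2)"
  have u': "(u has_real_derivative 2 * Re (cnj (p s) * q s)) (at s)" if s: "s \<in> {0..1}" for s
    unfolding u_def by (rule has_real_derivative_cmod_squared[OF p'[OF s]])
  have "continuous_on {0..1} u"
    by (intro continuous_at_imp_continuous_on ballI DERIV_isCont[OF u'])
  then obtain s0 where s0: "s0 \<in> {0..1}" and max: "\<And>s. s \<in> {0..1} \<Longrightarrow> u s \<le> u s0"
    using continuous_attains_sup[of "{0..1}" u] by auto
  have "s0 = 0 \<or> s0 = 1"
  proof (rule ccontr)
    assume "\<not> (s0 = 0 \<or> s0 = 1)"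
    then have s0': "0 < s0" "s0 < 1"
      using s0 by auto
    have "2 * Re (cnj (p s0) * q s0) = 0"
    proof (rule DERIV_local_max[OF u'[OF s0], of "min s0 (1 - s0)"])
      show "\<forall>y. \<bar>s0 - y\<bar> < min s0 (1 - s0) \<longrightarrow> u y \<le> u s0"
        by (intro allI impI max) auto
    qed (use s0' in auto)
    \<comment> \<open>The criticality condition in the form that exchanges \<open>cnj p\<close> for \<open>p\<close> in \<open>cnj p * q\<^sup>2\<close>.\<close>
    then have crit: "cnj (p s0) * q s0 = - (p s0 * cnj (q s0))"
      by (simp add: complex_eq_iff)
    define \<tau> where "\<tau> = deriv (deriv T) (p s0) / deriv T (p s0)"
    have "((\<lambda>s. cnj (p s) * q s) has_vector_derivative
        cnj (p s0) * (- (q s0)\<^sup>2 * deriv (deriv T) (p s0) / deriv T (p s0)) + cnj (q s0) * q s0) (at s0)"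
      by (intro has_vector_derivative_mult has_vector_derivative_cnj p'[OF s0] q'[OF s0])
    moreover have "cnj (p s0) * (- (q s0)\<^sup>2 * deriv (deriv T) (p s0) / deriv T (p s0)) + cnj (q s0) * q s0
        = of_real ((cmod (q s0))\<^sup>2) * (1 + p s0 * \<tau>)"
    proof -
      have "cnj (p s0) * (q s0)\<^sup>2 = - (p s0 * (q s0 * cnj (q s0)))"
        using arg_cong[OF crit, of "\<lambda>x. x * q s0"] by (simp add: power2_eq_square ac_simps)
      then have "cnj (p s0) * (- (q s0)\<^sup>2 * \<tau>) + cnj (q s0) * q s0
          = q s0 * cnj (q s0) * (1 + p s0 * \<tau>)"
        by (simp add: algebra_simps)
      then show ?thesis
        unfolding complex_norm_square \<tau>_def by simp
    qed
    ultimately have "((\<lambda>s. cnj (p s) * q s) has_vector_derivative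
        of_real ((cmod (q s0))\<^sup>2) * (1 + p s0 * \<tau>)) (at s0)"
      by simp
    from has_real_derivative_Re[OF this]
    have u'': "((\<lambda>s. Re (cnj (p s) * q s)) has_real_derivative
        (cmod (q s0))\<^sup>2 * (1 + Re (p s0 * \<tau>))) (at s0)"
      by (simp only: Re_of_real_mult plus_complex.sel one_complex.sel)
    have "q s0 \<noteq> 0"
      using v nz[OF p_disc[OF s0]] by (simp add: q_def)
    then have "0 < (cmod (q s0))\<^sup>2 * (1 + Re (p s0 * \<tau>))"
      using conv[OF p_disc[OF s0]] by (simp add: \<tau>_def)
    from DERIV_pos_inc_right[OF u'' this] crit obtain d where d: "d > 0"
        "\<And>h. 0 < h \<Longrightarrow> h < d \<Longrightarrow> Re (cnj (p s0) * q s0) < Re (cnj (p (s0 + h)) * q (s0 + h))"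
      by auto
    define h where "h = min (d / 2) (1 - s0)"
    have h: "0 < h" "h < d" "s0 + h \<le> 1"
      using d(1) s0' by (auto simp: h_def)
    have "u s0 < u (s0 + h)"
    proof (rule DERIV_pos_imp_increasing_open[of s0 "s0 + h" u])
      fix s assume s: "s0 < s" "s < s0 + h"
      have "0 = Re (cnj (p s0) * q s0)"
        using \<open>2 * Re (cnj (p s0) * q s0) = 0\<close> by simp
      also have "\<dots> < Re (cnj (p s) * q s)"
        using d(2)[of "s - s0"] s h by simp
      finally show "\<exists>y. (u has_real_derivative y) (at s) \<and> 0 < y"
        using u'[of s] s s0' h by (intro exI[of _ "2 * Re (cnj (p s) * q s)"]) auto
    next
      show "continuous_on {s0..s0 + h} u"
        using s0' h by (intro continuous_at_imp_continuous_on ballI DERIV_isCont[OF u']) auto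
    qed (use h in auto)
    with max[of "s0 + h"] h s0' show False
      by simp
  qed
  moreover have "p 0 = a" "p 1 = b"
    using ab by (simp_all add: p_def v_def g(3))
  ultimately have "u s0 \<le> (max (cmod a) (cmod b))\<^sup>2"
    by (auto simp: u_def intro!: power_mono)
  then have bound: "cmod (p s) \<le> max (cmod a) (cmod b)" if "s \<in> {0..1}" for s
    using max[OF that] by (intro power2_le_imp_le[of "cmod (p s)"]) (auto simp: u_def le_max_iff_disj)
  show ?thesis
  proof
    fix w assume "w \<in> closed_segment (T a) (T b)"
    then obtain s where s: "s \<in> {0..1}" "w = T a + of_real s * v"
      by (auto simp: in_segment v_def scaleR_conv_of_real algebra_simps)
    with bound[OF s(1)] T_p[OF s(1)] show "w \<in> T ` cball 0 (max (cmod a) (cmod b))"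
      by (intro image_eqI[of _ _ "p s"]) auto
  qed
qed

text \<open>
  For \<open>a\<close> and \<open>b\<close> in the disc, move the endpoint from \<open>T a\<close> to \<open>T b\<close> along the image of the segment
  from \<open>a\<close> to \<open>b\<close>.  The set \<open>A\<close> of times at which the segment from \<open>T a\<close> to the moving endpoint
  stays in the open set \<open>T ` unit_disc\<close> is open.  By the preceding maximum principle such a segment
  stays in the compact set \<open>T ` cball 0 r\<close> with \<open>r = max \<bar>a\<bar> \<bar>b\<bar> < 1\<close>, so \<open>A\<close> is closed as well.
\<close>
lemma convex_image_unit_disc:
  assumes hol: "T holomorphic_on unit_disc" and inj: "inj_on T unit_disc"
    and conv: "\<And>z. z \<in> unit_disc \<Longrightarrow> 0 < 1 + Re (z * deriv (deriv T) z / deriv T z)"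
  shows "convex (T ` unit_disc)"
proof -
  have "closed_segment (T a) (T b) \<subseteq> T ` unit_disc" if ab: "a \<in> unit_disc" "b \<in> unit_disc" for a b
  proof -
    define r where "r = max (cmod a) (cmod b)"
    have r: "r < 1" "a \<in> cball 0 r" "b \<in> cball 0 r"
      using ab by (auto simp: r_def)
    have contT: "continuous_on unit_disc T"
      by (rule holomorphic_on_imp_continuous_on[OF hol])
    have line_r: "linepath a b t \<in> cball 0 r" if "t \<in> {0..1}" for t
    proof -
      have "linepath a b t \<in> closed_segment a b"
        using that by (rule linepath_in_path)
      then show ?thesis
        using closed_segment_subset[OF r(2,3) convex_cball] by blast
    qed
    define \<Phi> where "\<Phi> = (\<lambda>(t, s). linepath (T a) (T (linepath a b t)) s)"
    define Q :: "(real \<times> real) set" where "Q = {0..1} \<times> {0..1}"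
    have "continuous_on Q (\<lambda>x. T (linepath a b (fst x)))"
    proof (rule continuous_on_compose2[OF contT])
      show "continuous_on Q (\<lambda>x. linepath a b (fst x))"
        unfolding linepath_def by (intro continuous_intros)
      have "cball 0 r \<subseteq> unit_disc"
        using r(1) by auto
      then show "(\<lambda>x. linepath a b (fst x)) ` Q \<subseteq> unit_disc"
        using line_r by (auto simp: Q_def)
    qed
    then have cont: "continuous_on Q \<Phi>"
      unfolding \<Phi>_def linepath_def case_prod_unfold by (intro continuous_intros)
    define A where "A = {t \<in> {0..1}. \<forall>s\<in>{0..1}. \<Phi> (t, s) \<in> T ` unit_disc}"
    \<comment> \<open>A projection of a compact subset of the square, so \<open>A\<close> is relatively open.\<close>
    have compl: "{0..1} - A = fst ` (Q \<inter> \<Phi> -` (- T ` unit_disc))"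
    proof (intro equalityI subsetI)
      fix t assume "t \<in> {0..1} - A"
      then obtain s where "(t, s) \<in> Q \<inter> \<Phi> -` (- T ` unit_disc)"
        unfolding A_def Q_def by blast
      then show "t \<in> fst ` (Q \<inter> \<Phi> -` (- T ` unit_disc))"
        by (intro image_eqI[of _ _ "(t, s)"]) simp_all
    next
      fix t assume "t \<in> fst ` (Q \<inter> \<Phi> -` (- T ` unit_disc))"
      then obtain s where "(t, s) \<in> Q \<inter> \<Phi> -` (- T ` unit_disc)"
        by auto
      then show "t \<in> {0..1} - A"
        unfolding A_def Q_def by blast
    qed
    have "open (T ` unit_disc)"
      by (rule open_mapping_thm3[OF hol open_ball inj])
    then have "closed (Q \<inter> \<Phi> -` (- T ` unit_disc))"
      by (intro continuous_closed_preimage[OF cont]) (auto simp: Q_def closed_Times)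
    moreover have "compact Q"
      by (simp add: Q_def compact_Times)
    ultimately have "compact (Q \<inter> (Q \<inter> \<Phi> -` (- T ` unit_disc)))"
      by (intro compact_Int_closed)
    then have "compact (Q \<inter> \<Phi> -` (- T ` unit_disc))"
      by (simp add: Int_absorb1)
    then have closed_compl: "closed ({0..1} - A)"
      unfolding compl by (intro compact_imp_closed compact_continuous_image continuous_intros)
    have in_K: "\<Phi> (t, s) \<in> T ` cball 0 r" if t: "t \<in> A" and s: "s \<in> {0..1}" for t s
    proof -
      have t': "t \<in> {0..1}"
        using t by (simp add: A_def)
      have "closed_segment (T a) (T (linepath a b t)) \<subseteq> T ` unit_disc"
        using t by (auto simp: A_def \<Phi>_def path_image_linepath[symmetric] path_image_def)
      then have "closed_segment (T a) (T (linepath a b t)) \<subseteq>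
          T ` cball 0 (max (cmod a) (cmod (linepath a b t)))"
        by (rule inverse_along_segment_bound[OF hol inj conv ab(1), rotated -1])
          (use line_r[OF t'] r(1) in auto)
      also have "\<dots> \<subseteq> T ` cball 0 r"
        using line_r[OF t'] r(2) by (intro image_mono) auto
      finally show ?thesis
        using linepath_in_path[OF s] by (auto simp: \<Phi>_def)
    qed
    have "A = {t \<in> {0..1}. \<forall>s\<in>{0..1}. \<Phi> (t, s) \<in> T ` cball 0 r}"
    proof -
      have "T ` cball 0 r \<subseteq> T ` unit_disc"
        using r(1) by (intro image_mono) auto
      then show ?thesis
        using in_K by (auto simp: A_def)
    qed
    also have "\<dots> = (\<Inter>s\<in>{0..1}. {0..1} \<inter> (\<lambda>t. \<Phi> (t, s)) -` (T ` cball 0 r))"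
      by force
    finally have A_eq: "A = (\<Inter>s\<in>{0..1}. {0..1} \<inter> (\<lambda>t. \<Phi> (t, s)) -` (T ` cball 0 r))" .
    have "compact (T ` cball 0 r)"
      by (intro compact_continuous_image continuous_on_subset[OF contT]) (use r(1) in auto)
    then have closedA: "closed A"
      unfolding A_eq
      by (intro closed_INT ballI continuous_closed_preimage compact_imp_closed
          continuous_on_compose2[OF cont]) (auto simp: Q_def intro!: continuous_intros)
    have "0 \<in> A"
      using ab by (auto simp: A_def \<Phi>_def linepath_def scaleR_conv_of_real algebra_simps)
    moreover have "connected {0..1::real}"
      by simp
    moreover have "{0..1} \<subseteq> A \<union> ({0..1} - A)" "A \<inter> ({0..1} - A) \<inter> {0..1} = {}" "0 \<in> {0..1::real}"
      by auto
    ultimately have "({0..1} - A) \<inter> {0..1} = {}"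
      unfolding connected_closed using closedA closed_compl by blast
    moreover have "1 \<in> {0..1::real}"
      by simp
    ultimately have "1 \<in> A"
      by blast
    then show ?thesis
      by (auto simp: A_def \<Phi>_def path_image_linepath[symmetric] path_image_def linepath_1')
  qed
  then show ?thesis
    by (auto simp: convex_contains_segment)
qed

section \<open>The shear\<close>

text \<open>
  On the horizontal line at height \<open>y\<close> fix a base point \<open>q y\<close>, in \<open>S\<close> if the line meets \<open>S\<close>.  Going
  from the base point to the right (\<open>u = 1\<close>) or to the left (\<open>u = - 1\<close>), the half-line that starts
  at the first point outside \<open>S\<close> never returns to \<open>S\<close>.  These half-lines cover the complement.
  If the line misses \<open>S\<close>, both of them start at the base point, and together they are the whole line.
\<close>
lemma horizontally_convex_imp_close_to_convex_domain:
  assumes S: "open S" "connected S" "S \<noteq> {}"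
    and hc: "\<And>x y. x \<in> S \<Longrightarrow> y \<in> S \<Longrightarrow> Im x = Im y \<Longrightarrow> closed_segment x y \<subseteq> S"
  shows "close_to_convex_domain S"
proof -
  define q where "q = (\<lambda>y. if \<exists>x. Complex x y \<in> S then Complex (SOME x. Complex x y \<in> S) y
    else Complex 0 y)"
  have Im_q: "Im (q y) = y" for y
    by (simp add: q_def)
  have q_in: "q (Im z) \<in> S" if "z \<in> S" for z
  proof -
    have "\<exists>x. Complex x (Im z) \<in> S"
      using that by (intro exI[of _ "Re z"]) simp
    from someI_ex[OF this] this show ?thesis
      by (simp add: q_def)
  qed
  define exit_at where "exit_at = (\<lambda>y u t. 0 \<le> t \<and> q y + of_real t * u \<notin> S \<and>
    (\<forall>s. 0 \<le> s \<and> s < t \<longrightarrow> q y + of_real s * u \<in> S))"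
  define R where "R = {(a, u). (u = 1 \<or> u = - 1) \<and> (\<exists>y t. exit_at y u t \<and> a = q y + of_real t * u)}"
  have exit_ex: "\<exists>t\<le>s. exit_at y u t" if out: "q y + of_real s * u \<notin> S" and s: "0 \<le> s" for y s u
  proof -
    define E where "E = {0..s} \<inter> (\<lambda>t. q y + of_real t * u) -` (- S)"
    have "closed E"
      unfolding E_def using S(1) by (intro continuous_closed_preimage continuous_intros) auto
    moreover have "bounded E"
      by (rule bounded_subset[OF bounded_closed_interval[of 0 s]]) (auto simp: E_def)
    ultimately have "compact E"
      by (simp add: compact_eq_bounded_closed)
    moreover have "s \<in> E"
      using out s by (simp add: E_def)
    ultimately obtain t where t: "t \<in> E" "\<And>t'. t' \<in> E \<Longrightarrow> t \<le> t'"
      using compact_attains_inf[of E] by blast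
    have "q y + of_real t' * u \<in> S" if "0 \<le> t'" "t' < t" for t'
      using t(2)[of t'] t(1) that by (force simp: E_def)
    with t(1) show ?thesis
      by (auto simp: E_def exit_at_def)
  qed
  have exit_out: "q y + of_real s * u \<notin> S"
    if ex: "exit_at y u t" and u: "u = 1 \<or> u = - 1" and "t \<le> s" for y u t s
  proof
    assume in_S: "q y + of_real s * u \<in> S"
    have Im: "Im (q y + of_real s * u) = y"
      using u Im_q by auto
    have t: "0 \<le> t" "q y + of_real t * u \<notin> S"
      using ex by (auto simp: exit_at_def)
    have "q y \<in> S"
      using q_in[OF in_S] Im by simp
    then have "closed_segment (q y) (q y + of_real s * u) \<subseteq> S"
      using in_S Im by (intro hc) (simp_all add: Im_q)
    moreover have "q y + of_real t * u \<in> closed_segment (q y) (q y + of_real s * u)"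
    proof (cases "s = 0")
      case True
      then show ?thesis
        using t \<open>t \<le> s\<close> by simp
    next
      case False
      then show ?thesis
        unfolding in_segment using t \<open>t \<le> s\<close>
        by (intro exI[of _ "t / s"]) (simp add: scaleR_conv_of_real algebra_simps)
    qed
    ultimately show False
      using t by blast
  qed
  have exit_unique: "t = t'" if "exit_at y u t" "exit_at y u t'" for y u t t'
    using that unfolding exit_at_def by (meson linorder_neqE_linordered_idom)
  have cover: "- S = (\<Union>(a, u)\<in>R. closed_half_line a u)"
  proof (intro equalityI subsetI)
    fix z assume z: "z \<in> - S"
    define s where "s = \<bar>Re z - Re (q (Im z))\<bar>"
    define u :: complex where "u = (if Re (q (Im z)) \<le> Re z then 1 else - 1)"
    have u: "u = 1 \<or> u = - 1"
      by (simp add: u_def)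
    have z_eq: "z = q (Im z) + of_real s * u"
      by (auto simp: complex_eq_iff Im_q s_def u_def)
    then obtain t where t: "t \<le> s" "exit_at (Im z) u t"
      using exit_ex[of "Im z" s u] z by (auto simp: s_def)
    then have "(q (Im z) + of_real t * u, u) \<in> R"
      using u by (auto simp: R_def)
    moreover have "z \<in> closed_half_line (q (Im z) + of_real t * u) u"
      unfolding closed_half_line_def using t(1)
      by (subst z_eq) (auto intro!: exI[of _ "s - t"] simp: algebra_simps)
    ultimately show "z \<in> (\<Union>(a, u)\<in>R. closed_half_line a u)"
      by blast
  next
    fix z assume "z \<in> (\<Union>(a, u)\<in>R. closed_half_line a u)"
    then obtain y t u t' where *: "u = 1 \<or> u = - 1" "exit_at y u t" "0 \<le> t'"
        "z = q y + of_real t * u + of_real t' * u"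
      by (auto simp: R_def closed_half_line_def)
    then have "z = q y + of_real (t + t') * u"
      by (simp add: algebra_simps)
    then show "z \<in> - S"
      using exit_out[OF *(2,1), of "t + t'"] *(3) by simp
  qed
  have disjoint: "disjnt (open_half_line a u) (open_half_line b v)"
    if lines: "(a, u) \<in> R" "(b, v) \<in> R" and distinct: "(a, u) \<noteq> (b, v)" for a u b v
    unfolding disjnt_iff
  proof (intro allI notI)
    fix z assume z: "z \<in> open_half_line a u \<and> z \<in> open_half_line b v"
    obtain y t where u: "u = 1 \<or> u = - 1" "exit_at y u t" "a = q y + of_real t * u"
      using lines(1) unfolding R_def by blast
    obtain y' t' where v: "v = 1 \<or> v = - 1" "exit_at y' v t'" "b = q y' + of_real t' * v"
      using lines(2) unfolding R_def by blast
    obtain s where s: "0 < s" "z = a + of_real s * u"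
      using z by (auto simp: open_half_line_def)
    obtain s' where s': "0 < s'" "z = b + of_real s' * v"
      using z by (auto simp: open_half_line_def)
    have "Im a = y" "Im b = y'"
      using u(1) v(1) by (auto simp: u(3) v(3) Im_q)
    moreover have "Im z = Im a"
      using s(2) u(1) by auto
    moreover have "Im z = Im b"
      using s'(2) v(1) by auto
    ultimately have y: "y = y'"
      by simp
    have pos: "0 \<le> t" "0 \<le> t'"
      using u(2) v(2) by (auto simp: exit_at_def)
    have "of_real (t + s) * u = of_real (t' + s') * v"
      using s(2) s'(2) u(3) v(3) y by (simp add: algebra_simps)
    then have "(t + s) * Re u = (t' + s') * Re v"
      by (metis Re_of_real_mult)
    then have "u = v"
      using u(1) v(1) pos s(1) s'(1) by auto
    with exit_unique u(2) v(2) y have "t = t'"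
      by metis
    with \<open>u = v\<close> y u(3) v(3) distinct show False
      by simp
  qed
  have "pairwise (\<lambda>(a, u) (b, v). disjnt (open_half_line a u) (open_half_line b v)) R"
  proof (rule pairwiseI)
    fix l l' assume "l \<in> R" "l' \<in> R" "l \<noteq> l'"
    then show "(case l of (a, u) \<Rightarrow> \<lambda>(b, v). disjnt (open_half_line a u) (open_half_line b v)) l'"
      using disjoint[of "fst l" "snd l" "fst l'" "snd l'"] by (simp add: case_prod_unfold)
  qed
  moreover have "\<forall>(a, u)\<in>R. cmod u = 1"
    by (auto simp: R_def)
  ultimately show ?thesis
    unfolding close_to_convex_domain_def using S cover by blast
qed

text \<open>
  In the coordinate \<open>w = T z\<close> the map is \<open>w \<mapsto> w + 2 Re (G (g w))\<close> with \<open>g = T\<^sup>-\<^sup>1\<close>.  It preserves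
  heights, and its derivative in the horizontal direction is
  \<open>1 + 2 Re (G' / T') = (\<bar>H'\<bar>\<^sup>2 - \<bar>G'\<bar>\<^sup>2) / \<bar>T'\<bar>\<^sup>2 > 0\<close>.  As the horizontal sections of the convex set
  \<open>T ` S\<close> are intervals, monotonicity gives injectivity and the intermediate value theorem gives
  horizontal convexity of the image.
\<close>
lemma shear_of_convex_map:
  assumes holH: "H holomorphic_on S" and holG: "G holomorphic_on S"
    and S: "open S" "connected S" "S \<noteq> {}"
    and inj: "inj_on (\<lambda>z. H z - G z) S" and conv: "convex ((\<lambda>z. H z - G z) ` S)"
    and sense: "\<And>z. z \<in> S \<Longrightarrow> cmod (deriv G z) < cmod (deriv H z)"
  shows "inj_on (harmonic_of H G) S" "close_to_convex_domain (harmonic_of H G ` S)"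
proof -
  define T where "T = (\<lambda>z. H z - G z)"
  define f where "f = harmonic_of H G"
  have hol: "T holomorphic_on S"
    unfolding T_def by (intro holomorphic_intros holH holG)
  obtain g where g: "g holomorphic_on (T ` S)"
      "\<And>z. z \<in> S \<Longrightarrow> deriv T z * deriv g (T z) = 1"
      "\<And>z. z \<in> S \<Longrightarrow> g (T z) = z"
    using holomorphic_has_inverse[OF hol S(1) inj[folded T_def]] by metis
  have open_image: "open (T ` S)"
    by (rule open_mapping_thm3[OF hol S(1) inj[folded T_def]])
  have f_eq: "f z = T z + of_real (2 * Re (G z))" for z
    by (simp add: f_def harmonic_of_def T_def complex_eq_iff)
  have T': "deriv T z = deriv H z - deriv G z" if "z \<in> S" for z
    unfolding T_def using holomorphic_on_imp_differentiable_at[OF holH S(1) that]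
      holomorphic_on_imp_differentiable_at[OF holG S(1) that] by (rule deriv_diff)
  have T'_nz: "deriv T z \<noteq> 0" if "z \<in> S" for z
    using sense[OF that] T'[OF that] by auto
  have pos: "0 < 1 + 2 * Re (deriv G z / deriv T z)" if "z \<in> S" for z
  proof -
    define d where "d = deriv T z"
    have "(cmod (deriv G z))\<^sup>2 < (cmod (d + deriv G z))\<^sup>2"
      using sense[OF that] T'[OF that] by (intro power_strict_mono) (auto simp: d_def)
    then have "0 < (Re d)\<^sup>2 + (Im d)\<^sup>2 + 2 * (Re (deriv G z) * Re d + Im (deriv G z) * Im d)"
      unfolding cmod_power2 by (simp add: power2_eq_square algebra_simps)
    moreover have d: "0 < (Re d)\<^sup>2 + (Im d)\<^sup>2"
      using T'_nz[OF that] unfolding d_def complex_neq_0 .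
    ultimately have "0 < ((Re d)\<^sup>2 + (Im d)\<^sup>2 + 2 * (Re (deriv G z) * Re d + Im (deriv G z) * Im d)) /
        ((Re d)\<^sup>2 + (Im d)\<^sup>2)"
      by (rule divide_pos_pos)
    also have "\<dots> = 1 + 2 * Re (deriv G z / d)"
      using less_imp_neq[OF d] by (simp add: Re_divide add_divide_distrib)
    finally show ?thesis
      by (simp only: d_def)
  qed
  \<comment> \<open>The harmonic map along the line through \<open>T a\<close> in the direction \<open>v\<close>.\<close>
  define P where "P = (\<lambda>a v s. f (g (T a + of_real s * v)))"
  have segment: "T a + of_real s * (T b - T a) \<in> T ` S" if "a \<in> S" "b \<in> S" "s \<in> {0..1}" for a b s
  proof -
    have "T a + of_real s * (T b - T a) = (1 - s) *\<^sub>R T a + s *\<^sub>R T b"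
      by (simp add: scaleR_conv_of_real algebra_simps)
    then show ?thesis
      using conv[folded T_def] that by (auto simp: convex_alt)
  qed
  have P_eq: "P a v s = T a + of_real s * v + of_real (2 * Re (G (g (T a + of_real s * v))))"
    if "T a + of_real s * v \<in> T ` S" for a v s
    using that g(3) by (auto simp: P_def f_eq)
  have P_Re: "((\<lambda>s. Re (P a (of_real x) s)) has_real_derivative
      x * (1 + 2 * Re (deriv G (g (T a + of_real s * of_real x)) / deriv T (g (T a + of_real s * of_real x))))) (at s)"
    if ins: "T a + of_real s * of_real x \<in> T ` S" for a x s
  proof -
    define w where "w = T a + of_real s * of_real x"
    obtain z where z: "z \<in> S" "w = T z"
      using ins by (auto simp: w_def)
    have gw: "g w = z"
      using z g(3) by simp
    have "((\<lambda>w. G (g w)) has_field_derivative deriv G (g w) * deriv g w) (at w)"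
      using z gw ins unfolding w_def[symmetric]
      by (intro DERIV_chain2[OF holomorphic_derivI[OF holG S(1)] holomorphic_derivI[OF g(1) open_image]])
        auto
    moreover have "deriv g w = 1 / deriv T z"
      using g(2)[OF z(1)] T'_nz[OF z(1)] z(2) by (simp add: field_simps)
    moreover define d where "d = deriv G z / deriv T z"
    ultimately have "((\<lambda>w. w + 2 * G (g w)) has_field_derivative 1 + 2 * d) (at w)"
      by (auto intro!: derivative_eq_intros simp: gw)
    from has_real_derivative_Re[OF has_vector_derivative_along_line[OF this[unfolded w_def]]]
    have der: "((\<lambda>s. Re (T a + of_real s * of_real x + 2 * G (g (T a + of_real s * of_real x))))
        has_real_derivative x * (1 + 2 * Re d)) (at s)"
      by simp
    have eq: "Re (T a + of_real s * of_real x + 2 * G (g (T a + of_real s * of_real x))) = Re (P a x s)"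
      if "s \<in> (\<lambda>s. T a + of_real s * of_real x) -` (T ` S)" for s
      using that P_eq[of a s x] by auto
    have preimage: "open ((\<lambda>s. T a + of_real s * of_real x) -` (T ` S))"
      by (rule open_vimage[OF open_image]) (intro continuous_intros)
    have "((\<lambda>s. Re (P a x s)) has_real_derivative x * (1 + 2 * Re d)) (at s)"
      by (rule has_field_derivative_transform_within_open[OF der preimage _ eq]) (simp add: ins)
    then show ?thesis
      using gw by (simp add: w_def d_def)
  qed
  have Im_f: "Im (f z) = Im (T z)" for z
    by (simp add: f_eq)
  have T_diff: "T b - T a = of_real (Re (T b) - Re (T a))" if "Im (f a) = Im (f b)" for a b
    using that by (simp add: complex_eq_iff Im_f)
  have ends: "P a (T b - T a) 0 = f a" "P a (T b - T a) 1 = f b" if "a \<in> S" "b \<in> S" for a b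
    using that g(3) by (auto simp: P_def)
  have not_less: "\<not> Re (T a) < Re (T b)" if ab: "a \<in> S" "b \<in> S" "f a = f b" for a b
  proof
    assume less: "Re (T a) < Re (T b)"
    define x where "x = Re (T b) - Re (T a)"
    have x: "T b - T a = of_real x" "0 < x"
      using T_diff[of a b] ab less by (auto simp: x_def)
    have "Re (P a x 0) < Re (P a x 1)"
    proof (rule DERIV_pos_imp_increasing[of 0 1 "\<lambda>s. Re (P a x s)", OF zero_less_one], intro exI conjI)
      fix s :: real assume "0 \<le> s" "s \<le> 1"
      then have ins: "T a + of_real s * of_real x \<in> T ` S"
        using segment[OF ab(1,2), of s] x by simp
      show "((\<lambda>s. Re (P a x s)) has_real_derivative x * (1 + 2 * Re (deriv G
          (g (T a + of_real s * of_real x)) / deriv T (g (T a + of_real s * of_real x))))) (at s)"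
        by (rule P_Re[OF ins])
      have "g (T a + of_real s * of_real x) \<in> S"
        using ins g(3) by auto
      from mult_pos_pos[OF x(2) pos[OF this]]
      show "0 < x * (1 + 2 * Re (deriv G (g (T a + of_real s * of_real x)) /
          deriv T (g (T a + of_real s * of_real x))))" .
    qed
    with ends[OF ab(1,2)] x ab(3) show False
      by simp
  qed
  show inj_f: "inj_on f S"
  proof (rule inj_onI)
    fix a b assume ab: "a \<in> S" "b \<in> S" "f a = f b"
    have "Re (T a) = Re (T b)"
      using not_less[OF ab] not_less[OF ab(2,1) ab(3)[symmetric]] by simp
    moreover have "Im (T a) = Im (T b)"
      using arg_cong[OF ab(3), of Im] unfolding Im_f .
    ultimately have "T a = T b"
      by (simp add: complex_eq_iff)
    then show "a = b"
      using inj_onD[OF inj[folded T_def]] ab(1,2) by blast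
  qed
  have cont: "continuous_on S f"
    unfolding f_def harmonic_of_def
    by (intro continuous_intros holomorphic_on_imp_continuous_on holH holG)
  show "close_to_convex_domain (f ` S)"
  proof (rule horizontally_convex_imp_close_to_convex_domain)
    show "open (f ` S)"
      by (rule invariance_of_domain[OF cont S(1) inj_f])
    show "connected (f ` S)"
      by (rule connected_continuous_image[OF cont S(2)])
    show "f ` S \<noteq> {}"
      using S(3) by simp
  next
    fix w1 w2 assume "w1 \<in> f ` S" "w2 \<in> f ` S" and Im: "Im w1 = Im w2"
    then obtain a b where ab: "a \<in> S" "b \<in> S" "w1 = f a" "w2 = f b"
      by auto
    define x where "x = Re (T b) - Re (T a)"
    have x: "T b - T a = of_real x"
      using T_diff[of a b] Im ab by (auto simp: x_def)
    have ins: "T a + of_real s * of_real x \<in> T ` S" if "s \<in> {0..1}" for s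
      using segment[OF ab(1,2) that] x by simp
    have "continuous_on {0..1} (\<lambda>s. Re (P a x s))"
      using P_Re[OF ins] by (intro continuous_at_imp_continuous_on ballI) (blast intro: DERIV_isCont)
    then have conn: "connected ((\<lambda>s. Re (P a x s)) ` {0..1})"
      by (rule connected_continuous_image) simp
    show "closed_segment w1 w2 \<subseteq> f ` S"
    proof
      fix w assume w: "w \<in> closed_segment w1 w2"
      then obtain t where t: "0 \<le> t" "t \<le> 1" "w = (1 - t) *\<^sub>R w1 + t *\<^sub>R w2"
        by (auto simp: in_segment)
      have "Re w = (1 - t) * Re w1 + t * Re w2"
        by (simp add: t)
      then have "Re w \<in> closed_segment (Re w1) (Re w2)"
        unfolding in_segment using t by (intro exI[of _ t]) simp
      moreover have "closed_segment (Re w1) (Re w2) \<subseteq> (\<lambda>s. Re (P a x s)) ` {0..1}"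
      proof (rule closed_segment_subset)
        show "Re w1 \<in> (\<lambda>s. Re (P a x s)) ` {0..1}"
          using ends(1)[OF ab(1,2)] x ab by (intro image_eqI[of _ _ 0]) auto
        show "Re w2 \<in> (\<lambda>s. Re (P a x s)) ` {0..1}"
          using ends(2)[OF ab(1,2)] x ab by (intro image_eqI[of _ _ 1]) auto
        show "convex ((\<lambda>s. Re (P a x s)) ` {0..1})"
          using conn by (simp add: connected_convex_1)
      qed
      ultimately obtain s where s: "s \<in> {0..1}" "Re w = Re (P a x s)"
        by auto
      have "Im w = Im w1"
        by (simp add: t Im algebra_simps)
      also have "\<dots> = Im (P a x s)"
        using P_eq[OF ins[OF s(1)]] ab Im_f by simp
      finally have "w = P a x s"
        using s by (simp add: complex_eq_iff)
      moreover have "g (T a + of_real s * of_real x) \<in> S"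
        using ins[OF s(1)] g(3) by auto
      ultimately show "w \<in> f ` S"
        by (simp add: P_def)
    qed
  qed
qed

section \<open>The integral operator\<close>

text \<open>
  If \<open>M\<close> is the branch of \<open>log (1 - z)\<close>, then \<open>z exp (L z + \<beta> M z) = \<phi> z\<close>.  Differentiating this
  identity, rather than a quotient with a removable singularity, gives
  \<open>z L' = z \<phi>' / \<phi> - 1 + \<beta> z / (1 - z)\<close> for \<open>z \<noteq> 0\<close>, and \<open>Re (z / (1 - z)) > - 1 / 2\<close> in the disc.
\<close>
lemma C_integrand_logarithm:
  assumes \<phi>: "\<phi> \<in> starlike_of_order \<delta>" and \<delta>: "0 \<le> \<delta>" "\<delta> < 1" and \<beta>: "0 \<le> \<beta>"
  obtains L where "L holomorphic_on unit_disc" "L 0 = 0"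
    "\<And>\<alpha> z. z \<in> unit_disc \<Longrightarrow> C_integrand \<alpha> \<beta> \<phi> z = exp (of_real \<alpha> * L z)"
    "\<And>z. z \<in> unit_disc \<Longrightarrow> - (2 * (1 - \<delta>) + \<beta>) / 2 \<le> Re (z * deriv L z)"
proof -
  have hol\<phi>: "\<phi> holomorphic_on unit_disc" and \<phi>0: "\<phi> 0 = 0" "deriv \<phi> 0 = 1"
    and star: "\<And>z. z \<in> unit_disc \<Longrightarrow> z \<noteq> 0 \<Longrightarrow> \<delta> < Re (z * deriv \<phi> z / \<phi> z)"
    using \<phi> by (auto simp: starlike_of_order_def)
  have \<phi>_nz: "\<phi> z \<noteq> 0" if "z \<in> unit_disc" "z \<noteq> 0" for z
    using star[OF that] \<delta>(1) by auto
  define Q where "Q = (\<lambda>z. if z = 0 then deriv \<phi> 0 else \<phi> z / z)"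
  have holQ: "Q holomorphic_on unit_disc"
    by (rule pole_theorem_open_0[OF hol\<phi> open_ball, of 0]) (auto simp: Q_def \<phi>0)
  define M where "M = log_branch (\<lambda>z. 1 - z)"
  have nz1: "1 - z \<noteq> 0" if "z \<in> unit_disc" for z :: complex
    using that by auto
  have M: "M holomorphic_on unit_disc" "M 0 = 0" "\<And>z. z \<in> unit_disc \<Longrightarrow> exp (M z) = 1 - z"
    unfolding M_def by (rule log_branch_properties; use nz1 in \<open>auto intro!: holomorphic_intros\<close>)+
  define g where "g = (\<lambda>z. Q z / power_branch (\<lambda>z. 1 - z) \<beta> z)"
  have g_eq: "g z = Q z / exp (of_real \<beta> * M z)" for z
    by (simp add: g_def power_branch_def M_def)
  have g: "g holomorphic_on unit_disc" "g 0 = 1" "\<And>z. z \<in> unit_disc \<Longrightarrow> g z \<noteq> 0"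
  proof -
    show "g holomorphic_on unit_disc"
      unfolding g_eq[abs_def] by (intro holomorphic_intros holQ M(1)) auto
    show "g 0 = 1"
      by (simp add: g_eq M(2) Q_def \<phi>0)
    show "g z \<noteq> 0" if "z \<in> unit_disc" for z
      using \<phi>_nz[OF that] by (simp add: g_eq Q_def \<phi>0)
  qed
  define L where "L = log_branch g"
  have L: "L holomorphic_on unit_disc" "L 0 = 0" "\<And>z. z \<in> unit_disc \<Longrightarrow> exp (L z) = g z"
    unfolding L_def by (rule log_branch_properties[OF g]; assumption)+
  have integrand: "C_integrand \<alpha> \<beta> \<phi> z = exp (of_real \<alpha> * L z)" for \<alpha> z
    by (simp add: C_integrand_def power_branch_def[of _ \<alpha>] L_def g_def Q_def)
  have "- (2 * (1 - \<delta>) + \<beta>) / 2 \<le> Re (z * deriv L z)" if z: "z \<in> unit_disc" for z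
  proof (cases "z = 0")
    case True
    then show ?thesis
      using \<delta> \<beta> by simp
  next
    case False
    have dL: "(L has_field_derivative deriv L z) (at z)"
      by (rule holomorphic_derivI[OF L(1) open_ball z])
    have dM: "(M has_field_derivative deriv M z) (at z)"
      by (rule holomorphic_derivI[OF M(1) open_ball z])
    have "((\<lambda>z. exp (M z)) has_field_derivative exp (M z) * deriv M z) (at z)"
      by (rule DERIV_fun_exp[OF dM])
    then have "((\<lambda>z. 1 - z) has_field_derivative exp (M z) * deriv M z) (at z)"
      by (rule has_field_derivative_transform_within_open[OF _ open_ball z]) (rule M(3))
    moreover have "((\<lambda>z. 1 - z) has_field_derivative - 1) (at z)"
      by (auto intro!: derivative_eq_intros)
    ultimately have "(1 - z) * deriv M z = - 1"
      using M(3)[OF z] DERIV_unique by fastforce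
    then have M': "deriv M z = - 1 / (1 - z)"
      using nz1[OF z] by (simp add: field_simps)
    have \<phi>_eq: "x * exp (L x + of_real \<beta> * M x) = \<phi> x" if "x \<in> unit_disc" for x
      using that by (simp add: exp_add L(3) g_eq Q_def \<phi>0)
    have "((\<lambda>z. z * exp (L z + of_real \<beta> * M z)) has_field_derivative
        exp (L z + of_real \<beta> * M z) * (1 + z * (deriv L z + of_real \<beta> * deriv M z))) (at z)"
      by (rule derivative_eq_intros dL dM refl)+ (simp add: algebra_simps)
    then have "(\<phi> has_field_derivative
        exp (L z + of_real \<beta> * M z) * (1 + z * (deriv L z + of_real \<beta> * deriv M z))) (at z)"
      by (rule has_field_derivative_transform_within_open[OF _ open_ball z]) (rule \<phi>_eq)
    then have "deriv \<phi> z = exp (L z + of_real \<beta> * M z) * (1 + z * (deriv L z + of_real \<beta> * deriv M z))"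
      by (rule DERIV_imp_deriv)
    then have "z * deriv \<phi> z / \<phi> z = 1 + z * (deriv L z + of_real \<beta> * deriv M z)"
      unfolding \<phi>_eq[OF z, symmetric] using False by simp
    then have "z * deriv L z = z * deriv \<phi> z / \<phi> z - 1 + of_real \<beta> * (z / (1 - z))"
      unfolding M' by (simp add: algebra_simps)
    then have "Re (z * deriv L z) = Re (z * deriv \<phi> z / \<phi> z) - 1 + \<beta> * Re (z / (1 - z))"
      by (simp only: plus_complex.sel minus_complex.sel one_complex.sel Re_of_real_mult)
    moreover have "- 1 / 2 \<le> Re (z / (1 - z))"
    proof -
      have "(cmod z)\<^sup>2 < 1"
        using z by (simp add: power_less_one_iff)
      then have "(Re z)\<^sup>2 + (Im z)\<^sup>2 < 1"
        by (simp add: cmod_power2)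
      moreover have "0 < (1 - Re z)\<^sup>2 + (Im z)\<^sup>2"
        using nz1[OF z] unfolding complex_neq_0 by simp
      ultimately show ?thesis
        by (simp add: Re_divide field_simps power2_eq_square)
    qed
    then have "\<beta> * (- 1 / 2) \<le> \<beta> * Re (z / (1 - z))"
      using \<beta> by (rule mult_left_mono)
    ultimately show ?thesis
      using star[OF z False] by simp
  qed
  with L(1,2) integrand show thesis
    by (rule that)
qed

lemma C_rot_has_derivative:
  assumes hol: "C_integrand \<alpha> \<beta> \<phi> holomorphic_on unit_disc" and z: "z \<in> unit_disc"
  shows "(C_rot \<theta> \<alpha> \<beta> \<phi> has_field_derivative C_integrand \<alpha> \<beta> \<phi> (exp (\<i> * of_real \<theta>) * z)) (at z)"
proof -
  obtain F where F: "\<And>x. x \<in> unit_disc \<Longrightarrow> (F has_field_derivative C_integrand \<alpha> \<beta> \<phi> x) (at x within unit_disc)"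
    using holomorphic_convex_primitive'[OF convex_ball open_ball hol] by blast
  have C_eq: "C_op \<alpha> \<beta> \<phi> x = F x - F 0" if "x \<in> unit_disc" for x
  proof -
    have "path_image (linepath 0 x) \<subseteq> unit_disc"
      using closed_segment_subset[OF _ that convex_ball] by simp
    from contour_integral_primitive[OF F valid_path_linepath this] show ?thesis
      unfolding C_op_def by (auto dest: contour_integral_unique)
  qed
  define e where "e = exp (\<i> * of_real \<theta>)"
  have e: "cmod e = 1" "exp (- \<i> * of_real \<theta>) * e = 1"
    by (simp_all add: e_def exp_minus field_simps)
  have ez: "e * z \<in> unit_disc"
    using z e by (simp add: norm_mult)
  have "(F has_field_derivative C_integrand \<alpha> \<beta> \<phi> (e * z)) (at (e * z))"
    using F[OF ez] at_within_open[OF ez open_ball] by simp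
  moreover have "((\<lambda>z. e * z) has_field_derivative e) (at z)"
    by (auto intro!: derivative_eq_intros)
  ultimately have "((\<lambda>z. F (e * z)) has_field_derivative C_integrand \<alpha> \<beta> \<phi> (e * z) * e) (at z)"
    by (rule DERIV_chain2)
  then have "((\<lambda>z. exp (- \<i> * of_real \<theta>) * (F (e * z) - F 0)) has_field_derivative
      exp (- \<i> * of_real \<theta>) * (C_integrand \<alpha> \<beta> \<phi> (e * z) * e)) (at z)"
    by (auto intro!: derivative_eq_intros)
  moreover have "exp (- \<i> * of_real \<theta>) * (C_integrand \<alpha> \<beta> \<phi> (e * z) * e) = C_integrand \<alpha> \<beta> \<phi> (e * z)"
    using e(2) by (metis mult.assoc mult.commute mult_1)
  ultimately have "((\<lambda>z. exp (- \<i> * of_real \<theta>) * (F (e * z) - F 0)) has_field_derivative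
      C_integrand \<alpha> \<beta> \<phi> (e * z)) (at z)"
    by (rule DERIV_cong)
  then have "(C_rot \<theta> \<alpha> \<beta> \<phi> has_field_derivative C_integrand \<alpha> \<beta> \<phi> (e * z)) (at z)"
  proof (rule has_field_derivative_transform_within_open[OF _ open_ball z])
    fix x assume "x \<in> unit_disc"
    then have "e * x \<in> unit_disc"
      using e by (simp add: norm_mult)
    then show "exp (- \<i> * of_real \<theta>) * (F (e * x) - F 0) = C_rot \<theta> \<alpha> \<beta> \<phi> x"
      by (simp add: C_rot_def C_eq e_def)
  qed
  then show ?thesis
    by (simp add: e_def)
qed

text \<open>
  The rotation leaves the bound unchanged: with \<open>e = exp (\<i> \<theta>)\<close> the quotient \<open>z T'' / T'\<close> at \<open>z\<close> is
  \<open>\<alpha>\<close> times the value of \<open>\<zeta> L' \<zeta>\<close> at \<open>\<zeta> = e z\<close>.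
\<close>
lemma C_rot_convex_of_order:
  fixes \<theta> :: real
  assumes \<phi>: "\<phi> \<in> starlike_of_order \<delta>" and \<delta>: "0 \<le> \<delta>" "\<delta> < 1" and \<alpha>: "0 \<le> \<alpha>" and \<beta>: "0 \<le> \<beta>"
  defines "T \<equiv> C_rot \<theta> \<alpha> \<beta> \<phi>"
  shows "T holomorphic_on unit_disc" "deriv T 0 = 1"
    "\<And>z. z \<in> unit_disc \<Longrightarrow> deriv T z \<noteq> 0"
    "\<And>z. z \<in> unit_disc \<Longrightarrow>
      - \<alpha> * (2 * (1 - \<delta>) + \<beta>) / 2 \<le> Re (z * deriv (deriv T) z / deriv T z)"
proof -
  obtain L where L: "L holomorphic_on unit_disc" "L 0 = 0"
    and integrand: "\<And>\<alpha> z. z \<in> unit_disc \<Longrightarrow> C_integrand \<alpha> \<beta> \<phi> z = exp (of_real \<alpha> * L z)"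
    and Re_L: "\<And>z. z \<in> unit_disc \<Longrightarrow> - (2 * (1 - \<delta>) + \<beta>) / 2 \<le> Re (z * deriv L z)"
    by (rule C_integrand_logarithm[OF \<phi> \<delta> \<beta>]) (rule that)
  define e where "e = exp (\<i> * of_real \<theta>)"
  have e: "e * z \<in> unit_disc" if "z \<in> unit_disc" for z
    using that by (simp add: e_def norm_mult)
  have "(\<lambda>z. exp (of_real \<alpha> * L z)) holomorphic_on unit_disc"
    by (intro holomorphic_intros L)
  then have hol: "C_integrand \<alpha> \<beta> \<phi> holomorphic_on unit_disc"
    by (rule holomorphic_transform) (simp add: integrand)
  have dT: "(T has_field_derivative exp (of_real \<alpha> * L (e * z))) (at z)" if "z \<in> unit_disc" for z
    using C_rot_has_derivative[OF hol that, of \<theta>]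
    unfolding T_def e_def[symmetric] integrand[OF e[OF that]] .
  have T': "deriv T z = exp (of_real \<alpha> * L (e * z))" if "z \<in> unit_disc" for z
    by (rule DERIV_imp_deriv[OF dT[OF that]])
  show "T holomorphic_on unit_disc"
    unfolding holomorphic_on_open[OF open_ball] using dT by blast
  show "deriv T 0 = 1"
    by (simp add: T' L)
  show "deriv T z \<noteq> 0" if "z \<in> unit_disc" for z
    using T'[OF that] by simp
  show "- \<alpha> * (2 * (1 - \<delta>) + \<beta>) / 2 \<le> Re (z * deriv (deriv T) z / deriv T z)"
    if z: "z \<in> unit_disc" for z
  proof -
    have dL: "(L has_field_derivative deriv L (e * z)) (at (e * z))"
      by (rule holomorphic_derivI[OF L(1) open_ball e[OF z]])
    have "((\<lambda>z. e * z) has_field_derivative e) (at z)"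
      by (auto intro!: derivative_eq_intros)
    then have "((\<lambda>z. L (e * z)) has_field_derivative deriv L (e * z) * e) (at z)"
      by (rule DERIV_chain2[where g = "\<lambda>z. e * z", OF dL])
    then have "((\<lambda>z. exp (of_real \<alpha> * L (e * z))) has_field_derivative
        exp (of_real \<alpha> * L (e * z)) * (of_real \<alpha> * (deriv L (e * z) * e))) (at z)"
      by (intro DERIV_fun_exp DERIV_cmult)
    then have "(deriv T has_field_derivative
        exp (of_real \<alpha> * L (e * z)) * (of_real \<alpha> * (deriv L (e * z) * e))) (at z)"
      by (rule has_field_derivative_transform_within_open[OF _ open_ball z]) (simp add: T')
    then have "deriv (deriv T) z = exp (of_real \<alpha> * L (e * z)) * (of_real \<alpha> * (deriv L (e * z) * e))"
      by (rule DERIV_imp_deriv)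
    then have "z * deriv (deriv T) z / deriv T z = of_real \<alpha> * (e * z * deriv L (e * z))"
      by (simp add: T'[OF z])
    then have "Re (z * deriv (deriv T) z / deriv T z) = \<alpha> * Re (e * z * deriv L (e * z))"
      by (simp only: Re_of_real_mult)
    moreover have "- \<alpha> * (2 * (1 - \<delta>) + \<beta>) / 2 = \<alpha> * (- (2 * (1 - \<delta>) + \<beta>) / 2)"
      by (simp add: algebra_simps)
    ultimately show ?thesis
      using mult_left_mono[OF Re_L[OF e[OF z]] \<alpha>] by (simp only:)
  qed
qed

theorem theorem5p1:
  fixes \<alpha> \<beta> \<delta> \<theta> c :: real and \<phi> w H G :: "complex \<Rightarrow> complex"
  assumes "0 \<le> \<delta>" and "\<delta> < 1"
    and "\<phi> \<in> starlike_of_order \<delta>"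
    and "0 \<le> \<theta>" and "\<theta> < pi"
    and "- 1 / 2 < c" and "c < 0"
    and "\<And>z. w z = of_real (cos (pi * c)) * z / 2"
    and "0 \<le> \<alpha>" and "0 \<le> \<beta>"
    and "\<alpha> * (1 + \<beta>) \<le> 1"
    and "\<alpha> * (2 * (1 - \<delta>) + \<beta>) \<le> - 2 * c"
    and "horizontal_shear (C_rot \<theta> \<alpha> \<beta> \<phi>) (\<lambda>z. of_real (\<alpha> * (1 + \<beta>)) * w z) H G"
    and "sense_preserving H G"
  shows "harmonic_of H G \<in> CC_H"
proof -
  define T where "T = C_rot \<theta> \<alpha> \<beta> \<phi>"
  note T = C_rot_convex_of_order[where \<theta> = \<theta>, OF assms(3,1,2,9,10), folded T_def]
  have order: "- 1 / 2 < Re (z * deriv (deriv T) z / deriv T z)" if "z \<in> unit_disc" for z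
    using T(4)[OF that] assms(6,12) by simp
  have inj: "inj_on T unit_disc"
    by (rule Re_deriv_pos_imp_inj_on[OF T(1) open_ball convex_ball])
      (rule convex_order_half_imp_Re_deriv_pos[OF T(1,2,3) order])
  have conv: "convex (T ` unit_disc)"
    by (rule convex_image_unit_disc[OF T(1) inj]) (use order in force)
  have shear: "H holomorphic_on unit_disc" "G holomorphic_on unit_disc"
      "\<And>z. z \<in> unit_disc \<Longrightarrow> T z = H z - G z" "H 0 = 0" "G 0 = 0" "deriv H 0 = 1"
    using assms(13) by (auto simp: horizontal_shear_def T_def)
  have "inj_on (\<lambda>z. H z - G z) unit_disc"
    using inj inj_on_cong[of unit_disc T "\<lambda>z. H z - G z"] shear(3) by blast
  moreover have "T ` unit_disc = (\<lambda>z. H z - G z) ` unit_disc"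
    by (rule image_cong[OF refl shear(3)])
  then have "convex ((\<lambda>z. H z - G z) ` unit_disc)"
    using conv by simp
  moreover have "cmod (deriv G z) < cmod (deriv H z)" if "z \<in> unit_disc" for z
  proof (rule power2_less_imp_less)
    show "(cmod (deriv G z))\<^sup>2 < (cmod (deriv H z))\<^sup>2"
      using assms(14) that by (simp add: sense_preserving_def)
  qed simp
  moreover have "unit_disc \<noteq> {}"
    by simp
  ultimately have "inj_on (harmonic_of H G) unit_disc"
      "close_to_convex_domain (harmonic_of H G ` unit_disc)"
    using shear_of_convex_map[OF shear(1,2) open_ball connected_ball] by blast+
  then show ?thesis
    unfolding CC_H_def using shear by blast
qed

end
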